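(* Let $\mathcal{C}$ be a graph class that is hereditary and separable with degree $\alpha\in(0,1)$. Then every graph $G\in\mathcal{C}$, say on $n$ vertices, admits a generalized elimination forest $(F,\eta)$ satisfying: (C1) $F$ has one root and every node of $F$ has at most seven children; (C2) $(F,\eta)$ has topological height at most $1+\log_2 n$ and height $\mathcal{O}(n^\alpha)$; (C3) for every node $x$ of $F$, if $i$ is the depth of $x$ in $F$, then $|\eta^{-1}(x)|\le\mathcal{O}((n/2^i)^\alpha)$, $|\eta^{-1}(\mathsf{subtree}[x])|\le n/2^i$, and $|N_G(\eta^{-1}(\mathsf{subtree}[x]))|\le\mathcal{O}((n/2^i)^\alpha)$. (The constants in the $\mathcal{O}$-notation depend only on $\mathcal{C}$.)
   Context: A graph class is hereditary if closed under taking induced subgraphs. $\mathcal{C}$ is separable with degree $\alpha$ if there is a constant $K$ such that for every $G\in\mathcal{C}$ on $n$ vertices and every $S\subseteq V(G)$ there exists $X\subseteq V(G)$ with $|X|\le Kn^\alpha$ such that every connected component of $G-X$ contains at most $|S|/2$ vertices of $S$. In a rooted forest $F$, $y\preceq x$ means $y$ is an ancestor of $x$ (including $x$ itself); $\mathsf{subtree}[x]$ is the set of descendants of $x$ including $x$; the depth (level) of $x$ is its number of strict ancestors; the height of $F$ is the maximum level plus one. A generalized elimination forest of $G$ is a pair $(F,\eta)$ with $F$ a rooted forest and $\eta\colon V(G)\to V(F)$ such that for every edge $uv\in E(G)$, $\eta(u)\preceq\eta(v)$ or $\eta(v)\preceq\eta(u)$. Its topological height is the height of $F$, and its height is $\max_{x\in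 V(F)}\sum_{y\preceq x}|\eta^{-1}(y)|$. $N_G(Y)$ denotes the set of vertices outside $Y$ adjacent to a vertex of $Y$. *)

theory Defs
  imports Complex_Main "Graph_Theory.Graph_Theory"
begin

(* Finite simple graphs are values of type 'a pair_pre_digraph satisfying pair_graph: finite,
   symmetric, loop-free; an undirected edge uv is the pair of arcs (u,v), (v,u).

   A class is a set of graphs whose vertices are drawn from one type 'a. Closure under
   isomorphism is not part of the definition, so isomorphism-closed classes are a special case. *)
definition graph_class :: "'a pair_pre_digraph set \<Rightarrow> bool" where
  "graph_class C \<longleftrightarrow> (\<forall>G\<in>C. pair_graph G)"

definition hereditary :: "'a pair_pre_digraph set \<Rightarrow> bool" where
  "hereditary C \<longleftrightarrow>
    (\<forall>G\<in>C. \<forall>H. induced_subgraph (with_proj H) (with_proj G) \<longrightarrow> H \<in> C)"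

(* On symmetric digraphs, the strongly connected components are the connected components of
   the undirected graph. *)
definition conn_components :: "'a pair_pre_digraph \<Rightarrow> 'a set \<Rightarrow> ('a, 'a \<times> 'a) pre_digraph set" where
  "conn_components G X = pre_digraph.sccs (with_proj G \<restriction> (pverts G - X))"

definition separable :: "'a pair_pre_digraph set \<Rightarrow> real \<Rightarrow> bool" where
  "separable C \<alpha> \<longleftrightarrow>
    (\<exists>K::real. \<forall>G\<in>C. \<forall>S \<subseteq> pverts G. \<exists>X \<subseteq> pverts G.
      real (card X) \<le> K * real (card (pverts G)) powr \<alpha> \<and>
      (\<forall>H \<in> conn_components G X. real (card (verts H \<inter> S)) \<le> real (card S) / 2))"

definition nbhd :: "'a pair_pre_digraph \<Rightarrow> 'a set \<Rightarrow> 'a set" where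
  "nbhd G Y = {v \<in> pverts G - Y. \<exists>u\<in>Y. u \<rightarrow>\<^bsub>with_proj G\<^esub> v}"

(* Arcs point from a parent to its children. Hence y is an ancestor of x (x itself included)
   iff x is reachable from y, and the children of x are its out-neighbours. *)
locale rooted_forest = pair_fin_digraph F for F :: "'b pair_pre_digraph" +
  assumes acyclic_arcs: "acyclic (parcs F)"
    and unique_parent: "x \<in> pverts F \<Longrightarrow> in_degree (with_proj F) x \<le> 1"

abbreviation anc :: "'b pair_pre_digraph \<Rightarrow> 'b \<Rightarrow> 'b \<Rightarrow> bool" where
  "anc F y x \<equiv> y \<rightarrow>\<^sup>*\<^bsub>with_proj F\<^esub> x"

definition roots :: "'b pair_pre_digraph \<Rightarrow> 'b set" where
  "roots F = {x \<in> pverts F. in_degree (with_proj F) x = 0}"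

definition subtree :: "'b pair_pre_digraph \<Rightarrow> 'b \<Rightarrow> 'b set" where
  "subtree F x = {z. anc F x z}"

definition depth :: "'b pair_pre_digraph \<Rightarrow> 'b \<Rightarrow> nat" where
  "depth F x = card {y. anc F y x \<and> y \<noteq> x}"

(* This and gef_height below take a maximum over all nodes, so they are meaningful only for
   forests with at least one node. *)
definition forest_height :: "'b pair_pre_digraph \<Rightarrow> nat" where
  "forest_height F = Max (depth F ` pverts F) + 1"

definition gen_elim_forest ::
    "'a pair_pre_digraph \<Rightarrow> 'b pair_pre_digraph \<Rightarrow> ('a \<Rightarrow> 'b) \<Rightarrow> bool" where
  "gen_elim_forest G F \<eta> \<longleftrightarrow>
    rooted_forest F \<and> \<eta> ` pverts G \<subseteq> pverts F \<and>
    (\<forall>(u, v) \<in> parcs G. anc F (\<eta> u) (\<eta> v) \<or> anc F (\<eta> v) (\<eta> u))"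

(* The inverse image of Y under \<eta>, where \<eta> is regarded as a function on the vertices of G only. *)
definition preimg :: "'a pair_pre_digraph \<Rightarrow> ('a \<Rightarrow> 'b) \<Rightarrow> 'b set \<Rightarrow> 'a set" where
  "preimg G \<eta> Y = {v \<in> pverts G. \<eta> v \<in> Y}"

definition gef_height ::
    "'a pair_pre_digraph \<Rightarrow> 'b pair_pre_digraph \<Rightarrow> ('a \<Rightarrow> 'b) \<Rightarrow> nat" where
  "gef_height G F \<eta> = Max ((\<lambda>x. \<Sum>y | anc F y x. card (preimg G \<eta> {y})) ` pverts F)"

end

(* A vertex set U at depth i comes with the bounds |U| <= m and |N(U)| <= c m^\<alpha>, where m = n / 2^i.
   Take two separators in G[U \<union> N(U)], one balanced for U and one balanced for N(U), and let X be
   their union. The components left over can be grouped into five groups, each with at most half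
   of U and at most half of N(U). A group has neighbours only in X and in its own half of N(U), so
   the bound on the neighbourhood is preserved as soon as |X| + c m^\<alpha> / 2 <= c (m / 2)^\<alpha>. Since
   \<alpha> < 1, we have 2^-\<alpha> > 1/2, and |X| = O((1 + c)^\<alpha> m^\<alpha>) is sublinear in c, so a large c works.
   The bag of the node is X \<inter> U and the groups within U are handed to its children. *)
theory Submission
  imports Defs "HOL-Library.Sublist" "HOL-Library.Countable" "HOL-Real_Asymp.Real_Asymp"
begin

section \<open>Splitting a vertex set\<close>

text \<open>
  The colouring \<open>f\<close> names the component of a vertex in \<open>G[W] - X\<close>. Keeping only these properties
  lets two separators be combined through pairs of colours, without comparing the components of
  \<open>G[W] - X\<^sub>1 - X\<^sub>2\<close> with those of \<open>G[W] - X\<^sub>1\<close> and \<open>G[W] - X\<^sub>2\<close>.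
\<close>

definition coloured_separators :: "'a pair_pre_digraph \<Rightarrow> real \<Rightarrow> real \<Rightarrow> bool" where
  "coloured_separators G K \<alpha> \<longleftrightarrow> (\<forall>W \<subseteq> pverts G. \<forall>S \<subseteq> W.
    (\<exists>X (f :: 'a \<Rightarrow> 'a set). X \<subseteq> W \<and> real (card X) \<le> K * real (card W) powr \<alpha> \<and>
      (\<forall>(u, v) \<in> parcs G. u \<in> W - X \<longrightarrow> v \<in> W - X \<longrightarrow> f u = f v) \<and>
      (\<forall>D. real (card {v \<in> S - X. f v = D}) \<le> real (card S) / 2)))"

text \<open>Heredity puts every induced subgraph \<open>G[W]\<close> into the class, so separability
  applies inside \<open>W\<close> with a bound in \<open>card W\<close>. Passing to
  \<open>max 1 K0\<close> makes the constant positive.\<close>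

lemma separable_coloured_separators:
  fixes C :: "'a pair_pre_digraph set"
  assumes "graph_class C" "hereditary C" "separable C \<alpha>"
  obtains K :: real where "K > 0"
    "\<And>G. G \<in> C \<Longrightarrow> coloured_separators G K \<alpha>"
proof -
  obtain K0 :: real where K0: "\<And>G S. G \<in> C \<Longrightarrow> S \<subseteq> pverts G \<Longrightarrow> \<exists>X \<subseteq> pverts G.
      real (card X) \<le> K0 * real (card (pverts G)) powr \<alpha> \<and>
      (\<forall>H \<in> conn_components G X. real (card (verts H \<inter> S)) \<le> real (card S) / 2)"
    using assms(3) unfolding separable_def by meson
  have "coloured_separators G (max 1 K0) \<alpha>" if G: "G \<in> C" for G
    unfolding coloured_separators_def
  proof (intro allI impI)
    fix W S assume W: "W \<subseteq> pverts G" and S: "S \<subseteq> W"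
    interpret G: pair_graph G using assms(1) G by (auto simp: graph_class_def)
    define H where "H = \<lparr> pverts = W, parcs = {e \<in> parcs G. fst e \<in> W \<and> snd e \<in> W} \<rparr>"
    have "wf_digraph (with_proj H)" by (auto simp: H_def wf_digraph_def)
    then have "induced_subgraph (with_proj H) (with_proj G)"
      using W unfolding induced_subgraph_def subgraph_def
      by (auto simp: H_def compatible_def G.wf_digraph_axioms)
    with assms(2) G have "H \<in> C" unfolding hereditary_def by blast
    with K0[of H S] S obtain X where X: "X \<subseteq> W" "real (card X) \<le> K0 * real (card W) powr \<alpha>"
      and comp: "\<And>D. D \<in> conn_components H X \<Longrightarrow> real (card (verts D \<inter> S)) \<le> real (card S) / 2"
      by (auto simp: H_def)
    define Q where "Q = with_proj H \<restriction> (pverts H - X)"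
    interpret Q: wf_digraph Q
      unfolding Q_def by (rule wf_digraph.wellformed_induce_subgraph) fact
    have vQ: "verts Q = W - X" by (simp add: Q_def H_def)
    let ?f = "pre_digraph.scc_of Q"
    have adj: "?f u = ?f v" if "(u, v) \<in> parcs G" "u \<in> W - X" "v \<in> W - X" for u v
    proof -
      \<comment> \<open>By symmetry of \<open>G\<close> the arc is present in both directions, so
        its ends are mutually reachable and share a strong component.\<close>
      have "(u, v) \<in> arcs Q" "(v, u) \<in> arcs Q"
        using that G.arcs_symmetric by (auto simp: Q_def H_def induce_subgraph_def)
      moreover have "tail Q = fst" "head Q = snd" by (auto simp: Q_def)
      ultimately have "u \<rightarrow>\<^bsub>Q\<^esub> v" "v \<rightarrow>\<^bsub>Q\<^esub> u"
        by (auto simp: arcs_ends_def arc_to_ends_def image_iff intro: bexI[rotated])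
      then have "u \<rightarrow>\<^sup>*\<^bsub>Q\<^esub> v" "v \<rightarrow>\<^sup>*\<^bsub>Q\<^esub> u" by auto
      then show ?thesis unfolding Q.scc_of_def by (auto intro: Q.reachable_trans)
    qed
    have fib: "real (card {v \<in> S - X. ?f v = D}) \<le> real (card S) / 2" for D
    \<comment> \<open>\<open>D\<close> is an arbitrary set; only a nonempty class forces it to be
      the vertex set of a component.\<close>
    proof (cases "{v \<in> S - X. ?f v = D} = {}")
      case True
      show ?thesis unfolding True by simp
    next
      case False
      then obtain v where v: "v \<in> S - X" "?f v = D" by blast
      then have "D \<in> pre_digraph.sccs_verts Q" using Q.scc_of_in_sccs_verts vQ S by auto
      then obtain Z where Z: "Z \<in> pre_digraph.sccs Q" "D = verts Z" by (auto simp: Q.sccs_verts_conv)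
      then have "Z \<in> conn_components H X" by (simp add: conn_components_def Q_def)
      note comp[OF this]
      moreover have "card {v \<in> S - X. ?f v = D} \<le> card (verts Z \<inter> S)"
      proof (rule card_mono)
        show "finite (verts Z \<inter> S)" by (meson S W G.pair_finite_verts finite_Int finite_subset)
        show "{v \<in> S - X. ?f v = D} \<subseteq> verts Z \<inter> S"
          using Q.in_scc_of_self vQ S Z by auto
      qed
      ultimately show ?thesis by linarith
    qed
    have "K0 * real (card W) powr \<alpha> \<le> max 1 K0 * real (card W) powr \<alpha>"
      by (intro mult_right_mono) auto
    with X adj fib show "\<exists>X (f :: 'a \<Rightarrow> 'a set). X \<subseteq> W \<and>
        real (card X) \<le> max 1 K0 * real (card W) powr \<alpha> \<and>
        (\<forall>(u, v) \<in> parcs G. u \<in> W - X \<longrightarrow> v \<in> W - X \<longrightarrow> f u = f v) \<and>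
        (\<forall>D. real (card {v \<in> S - X. f v = D}) \<le> real (card S) / 2)"
      by (intro exI[of _ X] exI[of _ ?f]) auto
  qed
  then show ?thesis by (intro that[of "max 1 K0"]) auto
qed

section \<open>Merging colour classes into five groups\<close>

lemma disjoint_colour_pairs_light:
  fixes f :: "'a \<Rightarrow> nat"
  assumes "finite A" and "distinct [a1, b1, a2, b2]"
  shows "2 * real (card {v \<in> A. f v \<in> {a1, b1}}) \<le> real (card A) \<or>
    2 * real (card {v \<in> A. f v \<in> {a2, b2}}) \<le> real (card A)"
proof -
  have "card {v \<in> A. f v \<in> {a1, b1}} + card {v \<in> A. f v \<in> {a2, b2}} =
      card ({v \<in> A. f v \<in> {a1, b1}} \<union> {v \<in> A. f v \<in> {a2, b2}})"
    using assms by (intro card_Un_disjoint[symmetric]) auto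
  also have "\<dots> \<le> card A" using assms by (intro card_mono) auto
  finally show ?thesis by linarith
qed

text \<open>Induction on the number of colours: as long as there are six, two of them can be
  identified without exceeding either half. The map \<open>h\<close> acts on colours, so vertices of
  equal colour stay together. The bounds \<open>a\<close> and \<open>b\<close> are kept apart from
  \<open>card A\<close> and \<open>card B\<close> because the halves are later measured before the
  separator is removed.\<close>

lemma merge_colours:
  fixes f :: "'a \<Rightarrow> nat" and A B :: "'a set"
  assumes fin: "finite A" "finite B"
    and "\<And>v. v \<in> A \<union> B \<Longrightarrow> f v < k"
    and "\<And>c. 2 * real (card {v \<in> A. f v = c}) \<le> real a" "\<And>c. 2 * real (card {v \<in> B. f v = c}) \<le> real b"
    and "card A \<le> a" "card B \<le> b"
  shows "\<exists>h. (\<forall>v \<in> A \<union> B. h (f v) < (5::nat)) \<and>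
    (\<forall>c. 2 * real (card {v \<in> A. h (f v) = c}) \<le> real a \<and> 2 * real (card {v \<in> B. h (f v) = c}) \<le> real b)"
  using assms(3-5)
proof (induction k arbitrary: f)
  case 0
  then have "A = {}" "B = {}" by auto
  then show ?case by simp
next
  case (Suc k)
  show ?case
  proof (cases "Suc k \<le> 5")
    case True
    then show ?thesis using Suc.prems by (intro exI[of _ "\<lambda>c. c"]) fastforce
  next
    case False
    let ?light = "\<lambda>x y. 2 * card {v \<in> A. f v \<in> {x, y}} \<le> a \<and> 2 * card {v \<in> B. f v \<in> {x, y}} \<le> b"
    \<comment> \<open>Of three disjoint pairs of colours at most one is too heavy for \<open>A\<close> and at most one for \<open>B\<close>.\<close>
    have "?light 0 1 \<or> ?light 2 3 \<or> ?light 4 5"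
      using disjoint_colour_pairs_light[OF fin(1), of 0 1 2 3 f] disjoint_colour_pairs_light[OF fin(1), of 0 1 4 5 f]
        disjoint_colour_pairs_light[OF fin(1), of 2 3 4 5 f] disjoint_colour_pairs_light[OF fin(2), of 0 1 2 3 f]
        disjoint_colour_pairs_light[OF fin(2), of 0 1 4 5 f] disjoint_colour_pairs_light[OF fin(2), of 2 3 4 5 f] assms(6,7)
      by simp linarith
    then obtain x y where xy: "?light x y" "x < y" "y \<le> 5"
      by (elim disjE) (force intro: that)+
    \<comment> \<open>\<open>y\<close> is merged into \<open>x\<close>, and the last colour
      \<open>k\<close> moves to the freed value \<open>y\<close>, so that all colours lie below
      \<open>k\<close>. If \<open>y = k\<close>, nothing has to move.\<close>
    define g where "g c = (if c = y then x else if c = k then y else c)" for c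
    have xk: "x \<noteq> k" "y \<le> k" using xy False by auto
    have fib: "{v \<in> M. g (f v) = c} = (if c = x then {v \<in> M. f v \<in> {x, y}} else if c = y then {v \<in> M. f v = k \<and> k \<noteq> y}
        else if c = k then {} else {v \<in> M. f v = c})" for M c
      using xk xy unfolding g_def by auto
    have "\<exists>h. (\<forall>v \<in> A \<union> B. h ((g \<circ> f) v) < (5::nat)) \<and>
      (\<forall>c. 2 * real (card {v \<in> A. h ((g \<circ> f) v) = c}) \<le> real a \<and> 2 * real (card {v \<in> B. h ((g \<circ> f) v) = c}) \<le> real b)"
    proof (rule Suc.IH)
      show "(g \<circ> f) v < k" if "v \<in> A \<union> B" for v
        using Suc.prems(1)[OF that] xk xy unfolding g_def by auto
      show "2 * real (card {v \<in> A. (g \<circ> f) v = c}) \<le> real a" for c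
        unfolding comp_def fib using xy(1) Suc.prems(2)[of c] Suc.prems(2)[of k] 
        by (cases "k = y") auto
      show "2 * real (card {v \<in> B. (g \<circ> f) v = c}) \<le> real b" for c
        unfolding comp_def fib using xy(1) Suc.prems(3)[of c] Suc.prems(3)[of k] 
        by (cases "k = y") auto
    qed
    then obtain h where "(\<forall>v \<in> A \<union> B. h ((g \<circ> f) v) < (5::nat)) \<and>
      (\<forall>c. 2 * real (card {v \<in> A. h ((g \<circ> f) v) = c}) \<le> real a \<and> 2 * real (card {v \<in> B. h ((g \<circ> f) v) = c}) \<le> real b)" ..
    then show ?thesis by (intro exI[of _ "h \<circ> g"]) simp
  qed
qed

section \<open>One splitting step and its constants\<close>

lemma boundary_constant:
  fixes \<alpha> K :: real
  assumes "0 < \<alpha>" "\<alpha> < 1" 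
  obtains c where "c > 0" "2 * K * (1 + c) powr \<alpha> + c / 2 \<le> c / 2 powr \<alpha>"
proof -
  \<comment> \<open>Dividing the goal by \<open>c\<close> leaves
    \<open>2 * K * (1 + c) powr \<alpha> / c \<le> e\<close>, whose left side tends to 0.\<close>
  define e where "e = 1 / 2 powr \<alpha> - 1 / 2"
  have "2 powr \<alpha> < 2 powr (1::real)" using assms by (intro powr_less_mono) auto
  then have e: "e > 0" by (simp add: e_def field_simps)
  have "((\<lambda>c. 2 * K * (1 + c) powr \<alpha> / c) \<longlongrightarrow> 0) at_top"
    using assms by real_asymp
  then have "eventually (\<lambda>c. 2 * K * (1 + c) powr \<alpha> / c < e) at_top"
    using e by (rule order_tendstoD)
  then obtain c where "c > 0" "2 * K * (1 + c) powr \<alpha> / c < e"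
    using eventually_conj[OF _ eventually_gt_at_top[of 0]] eventually_happens'[OF trivial_limit_at_top_linorder]
    by (metis (mono_tags, lifting))
  then show ?thesis by (intro that[of c]) (auto simp: field_simps e_def)
qed

text \<open>The invariant of the recursion. The scale \<open>m\<close> is a parameter and not
  \<open>card U\<close>: a part may be far smaller than \<open>m\<close>, while its neighbourhood is
  controlled only in terms of \<open>m\<close>.\<close>

definition small_part :: "'a pair_pre_digraph \<Rightarrow> real \<Rightarrow> real \<Rightarrow> real \<Rightarrow> 'a set \<Rightarrow> bool" where
  "small_part G \<alpha> c m U \<longleftrightarrow> U \<subseteq> pverts G \<and> real (card U) \<le> m \<and> real (card (nbhd G U)) \<le> c * m powr \<alpha>"

text \<open>\<open>X\<close> is the bag and the \<open>P j\<close> go to the children. Indexing the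
  parts by all numbers, empty from 5 on, lets the recursion be total on lists.\<close>

definition splits :: "'a pair_pre_digraph \<Rightarrow> 'a set \<Rightarrow> 'a set \<Rightarrow> (nat \<Rightarrow> 'a set) \<Rightarrow> bool" where
  "splits G U X P \<longleftrightarrow> X \<subseteq> U \<and> (\<Union>j. P j) = U - X \<and> disjoint_family P \<and>
    (\<forall>j. 2 * card (P j) \<le> card U) \<and> (\<forall>j \<ge> 5. P j = {}) \<and>
    (\<forall>j u v. (u, v) \<in> parcs G \<longrightarrow> u \<in> P j \<longrightarrow> v \<in> U \<longrightarrow> v \<in> X \<union> P j)"

lemma split_small_part:
  fixes G :: "'a pair_pre_digraph"
  assumes "pair_graph G"
    and sep: "coloured_separators G K \<alpha>"
    and "K > 0" "0 < \<alpha>" "\<alpha> < 1" "c > 0"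
    and const: "2 * K * (1 + c) powr \<alpha> + c / 2 \<le> c / 2 powr \<alpha>"
    and U: "small_part G \<alpha> c m U"
  shows "\<exists>X P. splits G U X P \<and> real (card X) \<le> 2 * K * (1 + c) powr \<alpha> * m powr \<alpha> \<and>
    (\<forall>j. small_part G \<alpha> c (m / 2) (P j))"
\<comment> \<open>The estimates need \<open>m \<ge> 1\<close>, which holds only when
  \<open>U\<close> has a vertex.\<close>
proof (cases "U = {}")
  case True
  with U have "m \<ge> 0" by (simp add: small_part_def)
  with True assms(3,6) show ?thesis
    by (intro exI[of _ "{}"] exI[of _ "\<lambda>_. {}"])
      (auto simp: splits_def small_part_def nbhd_def disjoint_family_on_def)
next
  case False
  interpret G: pair_graph G by fact
  have finG: "finite Z" if "Z \<subseteq> pverts G" for Z using that G.pair_finite_verts finite_subset by blast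
  define B where "B = nbhd G U"
  define W where "W = U \<union> B"
  have sub: "U \<subseteq> pverts G" "B \<subseteq> pverts G" "W \<subseteq> pverts G" "U \<subseteq> W" "B \<subseteq> W"
    using U by (auto simp: small_part_def W_def B_def nbhd_def)
  note fin = sub(1-3)[THEN finG]
  have cards: "real (card U) \<le> m" "real (card B) \<le> c * m powr \<alpha>"
    using U by (auto simp: small_part_def B_def)
  have "card U \<ge> 1" using False fin by (simp add: Suc_leI card_gt_0_iff)
  with cards have "m \<ge> 1" by simp
  obtain X1 and f1 :: "'a \<Rightarrow> 'a set" where "X1 \<subseteq> W \<and> real (card X1) \<le> K * real (card W) powr \<alpha> \<and>
      (\<forall>(u, v) \<in> parcs G. u \<in> W - X1 \<longrightarrow> v \<in> W - X1 \<longrightarrow> f1 u = f1 v) \<and>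
      (\<forall>D. real (card {v \<in> U - X1. f1 v = D}) \<le> real (card U) / 2)"
    using sep sub(3,4) unfolding coloured_separators_def by meson
  then have 1: "X1 \<subseteq> W" "real (card X1) \<le> K * real (card W) powr \<alpha>"
    "\<And>u v. (u, v) \<in> parcs G \<Longrightarrow> u \<in> W - X1 \<Longrightarrow> v \<in> W - X1 \<Longrightarrow> f1 u = f1 v"
    "\<And>D. real (card {v \<in> U - X1. f1 v = D}) \<le> real (card U) / 2"
    by (simp_all add: split_beta Ball_def del: Diff_iff)
  obtain X2 and f2 :: "'a \<Rightarrow> 'a set" where "X2 \<subseteq> W \<and> real (card X2) \<le> K * real (card W) powr \<alpha> \<and>
      (\<forall>(u, v) \<in> parcs G. u \<in> W - X2 \<longrightarrow> v \<in> W - X2 \<longrightarrow> f2 u = f2 v) \<and>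
      (\<forall>D. real (card {v \<in> B - X2. f2 v = D}) \<le> real (card B) / 2)"
    using sep sub(3,5) unfolding coloured_separators_def by meson
  then have 2: "X2 \<subseteq> W" "real (card X2) \<le> K * real (card W) powr \<alpha>"
    "\<And>u v. (u, v) \<in> parcs G \<Longrightarrow> u \<in> W - X2 \<Longrightarrow> v \<in> W - X2 \<Longrightarrow> f2 u = f2 v"
    "\<And>D. real (card {v \<in> B - X2. f2 v = D}) \<le> real (card B) / 2"
    by (simp_all add: split_beta Ball_def del: Diff_iff)
  define Y where "Y = X1 \<union> X2"
  have finY: "finite Y" using 1(1) 2(1) fin by (auto simp: Y_def intro: finite_subset)
  \<comment> \<open>Arcs within \<open>W - Y\<close> preserve both colours. A class of the product
    colouring lies in one class of \<open>f1\<close> and in one of \<open>f2\<close>, so it is light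
    for \<open>U\<close> and for \<open>B\<close>.\<close>
  define f where "f v = (f1 v, f2 v)" for v
  \<comment> \<open>The finitely many pairs that occur are numbered, since
    \<open>merge_colours\<close> works with colours below some \<open>k\<close>.\<close>
  obtain enc :: "'a set \<times> 'a set \<Rightarrow> nat" and k where enc: "enc ` f ` W = {i. i < k}" "inj_on enc (f ` W)"
    using finite_imp_inj_to_nat_seg[of "f ` W"] fin by blast
  have "\<exists>h. (\<forall>v \<in> (U - Y) \<union> (B - Y). h ((enc \<circ> f) v) < (5::nat)) \<and>
    (\<forall>c. 2 * real (card {v \<in> U - Y. h ((enc \<circ> f) v) = c}) \<le> real (card U) \<and>
      2 * real (card {v \<in> B - Y. h ((enc \<circ> f) v) = c}) \<le> real (card B))"
  proof (rule merge_colours)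
    show "finite (U - Y)" "finite (B - Y)" "card (U - Y) \<le> card U" "card (B - Y) \<le> card B"
      using fin by (auto intro: card_mono)
    show "(enc \<circ> f) v < k" if "v \<in> U - Y \<union> (B - Y)" for v
    proof -
      have "enc (f v) \<in> enc ` f ` W" using that sub(4,5) by blast
      then show ?thesis unfolding enc(1) by simp
    qed
    show "2 * real (card {v \<in> U - Y. (enc \<circ> f) v = c}) \<le> real (card U)" for c
    proof (cases "{v \<in> U - Y. (enc \<circ> f) v = c} = {}")
      case False
      then obtain w where w: "w \<in> U" "enc (f w) = c" by auto
      have "f v = f w" if "v \<in> U" "enc (f v) = c" for v
        using that w inj_onD[OF enc(2), of "f v" "f w"] sub(4) by auto
      then have "card {v \<in> U - Y. (enc \<circ> f) v = c} \<le> card {v \<in> U - X1. f1 v = f1 w}"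
        using fin by (intro card_mono) (auto simp: Y_def f_def)
      with 1(4)[of "f1 w"] show ?thesis by linarith
    next
      case True show ?thesis unfolding True by simp
    qed
    show "2 * real (card {v \<in> B - Y. (enc \<circ> f) v = c}) \<le> real (card B)" for c
    proof (cases "{v \<in> B - Y. (enc \<circ> f) v = c} = {}")
      case False
      then obtain w where w: "w \<in> B" "enc (f w) = c" by auto
      have "f v = f w" if "v \<in> B" "enc (f v) = c" for v
        using that w inj_onD[OF enc(2), of "f v" "f w"] sub(5) by auto
      then have "card {v \<in> B - Y. (enc \<circ> f) v = c} \<le> card {v \<in> B - X2. f2 v = f2 w}"
        using fin by (intro card_mono) (auto simp: Y_def f_def)
      with 2(4)[of "f2 w"] show ?thesis by linarith
    next
      case True show ?thesis unfolding True by simp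
    qed
  qed
  then obtain h where h: "\<And>v. v \<in> W - Y \<Longrightarrow> h (enc (f v)) < (5::nat)"
    "\<And>c. 2 * real (card {v \<in> U - Y. h (enc (f v)) = c}) \<le> real (card U)"
    "\<And>c. 2 * real (card {v \<in> B - Y. h (enc (f v)) = c}) \<le> real (card B)"
    unfolding W_def by auto
  define g where "g v = h (enc (f v))" for v
  have adj: "g u = g v" if "(u, v) \<in> parcs G" "u \<in> W - Y" "v \<in> W - Y" for u v
    using 1(3)[OF that(1)] 2(3)[OF that(1)] that(2,3) by (simp add: g_def f_def Y_def)
  define P where "P j = {v \<in> U - Y. g v = j}" for j
  \<comment> \<open>\<open>Y\<close> may also meet the neighbourhood of \<open>U\<close>; only its
    vertices in \<open>U\<close> form the bag, but all of \<open>Y\<close> may border on the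
    parts.\<close>
  have "splits G U (Y \<inter> U) P"
  proof -
    have "v \<in> Y \<inter> U \<union> P j" if "(u, v) \<in> parcs G" "u \<in> P j" "v \<in> U" for j u v
      using adj[OF that(1)] that sub(4)[THEN subsetD, of u] sub(4)[THEN subsetD, of v] by (auto simp: P_def)
    moreover have "P j = {}" if "j \<ge> 5" for j
    proof -
      have "g v \<noteq> j" if "v \<in> U - Y" for v
        using h(1)[of v] that sub(4) \<open>j \<ge> 5\<close> by (auto simp: g_def)
      then show ?thesis by (auto simp: P_def)
    qed
    moreover have "2 * card (P j) \<le> card U" for j
      using h(2)[of j] by (simp add: P_def g_def)
    ultimately show ?thesis
      unfolding splits_def by (intro conjI) (auto simp: P_def disjoint_family_on_def)
  qed
  moreover have cY: "real (card Y) \<le> 2 * K * (1 + c) powr \<alpha> * m powr \<alpha>"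
  proof -
    \<comment> \<open>From \<open>m powr \<alpha> \<le> m\<close> follows
      \<open>card W \<le> (1 + c) * m\<close>, and each of the two separators costs at most
      \<open>K * ((1 + c) * m) powr \<alpha>\<close>.\<close>
    have "m powr \<alpha> \<le> m powr 1" using \<open>m \<ge> 1\<close> assms(5) by (intro powr_mono) auto
    then have "c * m powr \<alpha> \<le> c * m" using \<open>c > 0\<close> \<open>m \<ge> 1\<close> by simp
    moreover have "card W \<le> card U + card B" unfolding W_def by (rule card_Un_le)
    ultimately have "real (card W) \<le> (1 + c) * m" using cards by (simp add: algebra_simps)
    then have "real (card W) powr \<alpha> \<le> ((1 + c) * m) powr \<alpha>"
      using assms(4) by (intro powr_mono2) auto
    also have "\<dots> = (1 + c) powr \<alpha> * m powr \<alpha>"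
      using \<open>c > 0\<close> \<open>m \<ge> 1\<close> by (simp add: powr_mult)
    finally have *: "K * real (card W) powr \<alpha> \<le> K * ((1 + c) powr \<alpha> * m powr \<alpha>)"
      using \<open>K > 0\<close> by simp
    have "card Y \<le> card X1 + card X2" unfolding Y_def by (rule card_Un_le)
    with 1(2) 2(2) * show ?thesis by (simp add: algebra_simps)
  qed
  moreover have "small_part G \<alpha> c (m / 2) (P j)" for j
  proof -
    \<comment> \<open>A neighbour of \<open>P j\<close> outside \<open>Y\<close> has colour
      \<open>j\<close>. In \<open>U\<close> it would belong to \<open>P j\<close> itself, so it lies
      in \<open>B\<close>.\<close>
    have "nbhd G (P j) \<subseteq> Y \<union> {v \<in> B - Y. g v = j}"
    proof
      fix v assume v: "v \<in> nbhd G (P j)"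
      then obtain u where u: "(u, v) \<in> parcs G" "u \<in> P j" by (auto simp: nbhd_def)
      then have "u \<in> U" by (simp add: P_def)
      with v u(1) have "v \<in> W" by (auto simp: W_def B_def nbhd_def)
      with adj[OF u(1)] v u(2) sub(4)[THEN subsetD, of u] show "v \<in> Y \<union> {v \<in> B - Y. g v = j}"
        by (auto simp: P_def W_def nbhd_def)
    qed
    then have "card (nbhd G (P j)) \<le> card (Y \<union> {v \<in> B - Y. g v = j})"
      using finY fin by (intro card_mono) auto
    also have "\<dots> \<le> card Y + card {v \<in> B - Y. g v = j}" by (rule card_Un_le)
    finally have "real (card (nbhd G (P j))) \<le> 2 * K * (1 + c) powr \<alpha> * m powr \<alpha> + c * m powr \<alpha> / 2"
      using cY h(3)[of j] cards(2) by (simp add: g_def)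
    also have "\<dots> = (2 * K * (1 + c) powr \<alpha> + c / 2) * m powr \<alpha>" by (simp add: algebra_simps)
    also have "\<dots> \<le> c / 2 powr \<alpha> * m powr \<alpha>" using const by (intro mult_right_mono) auto
    also have "\<dots> = c * (m / 2) powr \<alpha>" using \<open>m \<ge> 1\<close> by (simp add: powr_divide)
    finally show ?thesis
      using h(2)[of j] cards(1) sub(1) by (auto simp: small_part_def P_def g_def)
  qed
  moreover have "card (Y \<inter> U) \<le> card Y" using finY by (intro card_mono) auto
  ultimately show ?thesis
    by (intro exI[of _ "Y \<inter> U"] exI[of _ P]) auto
qed

section \<open>Rooted trees of lists\<close>

text \<open>The list \<open>j # p\<close> encodes the \<open>j\<close>-th child of \<open>p\<close>, so ancestors are suffixes.\<close>

definition list_tree :: "nat list set \<Rightarrow> nat pair_pre_digraph" where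
  "list_tree T = \<lparr> pverts = to_nat ` T, parcs = {(to_nat p, to_nat (j # p)) | j p. j # p \<in> T} \<rparr>"

lemma pverts_list_tree [simp]: "pverts (list_tree T) = to_nat ` T"
  by (simp add: list_tree_def)

locale suffix_closed =
  fixes T :: "nat list set"
  assumes finite_T: "finite T" and Nil_in: "[] \<in> T" and tl_in: "j # p \<in> T \<Longrightarrow> p \<in> T"
begin

lemma pair_fin_digraph_list_tree: "pair_fin_digraph (list_tree T)"
proof
  show "fst e \<in> pverts (list_tree T)" "snd e \<in> pverts (list_tree T)" if "e \<in> parcs (list_tree T)" for e
    using that tl_in by (auto simp: list_tree_def)
  show "finite (pverts (list_tree T))" using finite_T by (simp add: list_tree_def)
  have "parcs (list_tree T) \<subseteq> to_nat ` T \<times> to_nat ` T"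
    using tl_in by (auto simp: list_tree_def)
  then show "finite (parcs (list_tree T))" using finite_T finite_subset by blast
qed

interpretation F: pair_fin_digraph "list_tree T" by (rule pair_fin_digraph_list_tree)

lemma in_arcs_list_tree:
  "in_arcs (list_tree T) (to_nat q) = (if q \<noteq> [] \<and> q \<in> T then {(to_nat (tl q), to_nat q)} else {})"
  by (cases q) (auto simp: in_arcs_def list_tree_def)

lemma roots_list_tree: "roots (list_tree T) = {to_nat ([] :: nat list)}"
  using Nil_in by (auto simp: roots_def in_degree_def in_arcs_list_tree split: if_splits)

lemma out_degree_list_tree:
  assumes "\<And>j p. j # p \<in> T \<Longrightarrow> j < k"
  shows "out_degree (list_tree T) x \<le> k"
proof -
  have "out_arcs (list_tree T) x \<subseteq> (\<lambda>j. (x, to_nat (j # (from_nat x :: nat list)))) ` {..<k}"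
    using assms by (auto simp: out_arcs_def list_tree_def)
  then have "card (out_arcs (list_tree T) x) \<le> card {..<k}"
    by (rule surj_card_le[rotated]) simp
  then show ?thesis by (simp add: out_degree_def)
qed

lemma rooted_forest_list_tree: "rooted_forest (list_tree T)"
proof
  show "acyclic (parcs (list_tree T))"
    \<comment> \<open>Length grows along arcs, whereas the criterion wants a decreasing measure;
      hence the converse relation.\<close>
    by (rule acyclicI_order[where f = "\<lambda>x. length (from_nat x :: nat list)", THEN acyclic_converse[THEN iffD1]])
      (auto simp: list_tree_def)
  show "in_degree (list_tree T) x \<le> 1" if "x \<in> pverts (list_tree T)" for x
    using that by (auto simp: in_degree_def in_arcs_list_tree)
qed

lemma anc_list_tree:
  "anc (list_tree T) x (to_nat q) \<longleftrightarrow> q \<in> T \<and> (\<exists>p. x = to_nat p \<and> suffix p q)"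
proof
  assume "anc (list_tree T) x (to_nat q)"
  then show "q \<in> T \<and> (\<exists>p. x = to_nat p \<and> suffix p q)"
  proof (induction "to_nat q" arbitrary: q rule: F.reachable_induct)
    case base
    then show ?case by (auto simp: list_tree_def)
  next
    case (step y)
    then obtain j p where "y = to_nat p" "q = j # p" "q \<in> T" by (auto simp: list_tree_def)
    with step show ?case by (auto intro: suffix_ConsI)
  qed
next
  have "anc (list_tree T) (to_nat p) (to_nat q)" if "q \<in> T" "suffix p q" for p q
    using that
  proof (induction q)
    case (Cons j q)
    show ?case
    proof (cases "p = j # q")
      case True
      with Cons.prems show ?thesis by simp
    next
      case False
      with Cons have "anc (list_tree T) (to_nat p) (to_nat q)" by (auto simp: suffix_Cons tl_in)
      moreover have "(to_nat q, to_nat (j # q)) \<in> parcs (list_tree T)"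
        using Cons.prems by (auto simp: list_tree_def)
      ultimately show ?thesis by (auto intro: F.reachable_adj_trans)
    qed
  qed simp
  then show "q \<in> T \<and> (\<exists>p. x = to_nat p \<and> suffix p q) \<Longrightarrow> anc (list_tree T) x (to_nat q)" by blast
qed

text \<open>Enumerating the suffixes by the number of dropped entries is injective, which serves
  both for counting ancestors and for summing over them.\<close>

lemma ancestors_list_tree:
  assumes "q \<in> T"
  shows "{x. anc (list_tree T) x (to_nat q)} = to_nat ` (\<lambda>i. drop i q) ` {..length q}"
  using assms by (auto simp: anc_list_tree suffix_drop) (metis atMost_iff diff_le_self imageI suffix_take suffix_def append_eq_conv_conj length_append le_add1)

lemma depth_list_tree:
  assumes "q \<in> T"
  shows "depth (list_tree T) (to_nat q) = length q"
proof -
  have "{x. anc (list_tree T) x (to_nat q) \<and> x \<noteq> to_nat q} =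
      {x. anc (list_tree T) x (to_nat q)} - {to_nat q}" by auto
  also have "card \<dots> = card {x. anc (list_tree T) x (to_nat q)} - 1"
    using assms by (subst card_Diff_singleton) (auto simp: anc_list_tree)
  also have "card {x. anc (list_tree T) x (to_nat q)} = card ((\<lambda>i. drop i q) ` {..length q})"
    using assms by (simp add: ancestors_list_tree card_image)
  also have "\<dots> = Suc (length q)"
    by (subst card_image) (auto simp: inj_on_def dest: arg_cong[where f = length])
  finally show ?thesis by (simp add: depth_def)
qed

lemma subtree_list_tree: "p \<in> T \<Longrightarrow> subtree (list_tree T) (to_nat p) = to_nat ` {q \<in> T. suffix p q}"
  using F.reachable_in_verts(2)
  by (auto simp: subtree_def anc_list_tree) (fastforce simp: anc_list_tree)

text \<open>The maximum is attained because \<open>T\<close> is finite and contains the root, so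
  bounding the height means bounding the length of a single list.\<close>

lemma forest_height_list_tree:
  obtains q where "q \<in> T" "forest_height (list_tree T) = length q + 1"
proof -
  have "Max (depth (list_tree T) ` pverts (list_tree T)) \<in> depth (list_tree T) ` to_nat ` T"
    using finite_T Nil_in by (intro Max_in[THEN subsetD[rotated]]) auto
  then show ?thesis using that by (auto simp: forest_height_def depth_list_tree)
qed

end

section \<open>The elimination tree\<close>

text \<open>\<open>U p\<close> is the set handed to node \<open>p\<close> and \<open>X p\<close> its
  bag, for all lists \<open>p\<close>. Only the splitting property is fixed here; bounds on the bags
  enter where the height is estimated.\<close>

locale separator_tree =
  fixes G :: "'a pair_pre_digraph" and U X :: "nat list \<Rightarrow> 'a set"
  assumes pair_graph_G: "pair_graph G"
    and U_Nil: "U [] = pverts G"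
    and splits_U: "splits G (U p) (X p) (\<lambda>j. U (j # p))"
begin

interpretation G: pair_graph G by (rule pair_graph_G)

text \<open>The empty list is inserted so that the tree of an empty graph still has its
  root.\<close>

definition nodes :: "nat list set" where
  "nodes = insert [] {p. U p \<noteq> {}}"

definition node_of :: "'a \<Rightarrow> nat list" where
  "node_of v = (SOME p. v \<in> X p)"

lemma X_subset: "X p \<subseteq> U p"
  and UN_children: "(\<Union>j. U (j # p)) = U p - X p"
  and disjoint_children: "v \<in> U (i # p) \<Longrightarrow> v \<in> U (j # p) \<Longrightarrow> i = j"
  and card_child: "2 * card (U (j # p)) \<le> card (U p)"
  and child_empty: "j \<ge> 5 \<Longrightarrow> U (j # p) = {}"
  and child_nbhd: "(u, v) \<in> parcs G \<Longrightarrow> u \<in> U (j # p) \<Longrightarrow> v \<in> U p \<Longrightarrow> v \<in> X p \<union> U (j # p)"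
  using splits_U[of p] unfolding splits_def disjoint_family_on_def by blast+

section \<open>The node of a vertex\<close>

lemma U_mono:
  assumes "suffix p q"
  shows "U q \<subseteq> U p"
proof -
  obtain zs where "q = zs @ p" using assms by (auto simp: suffix_def)
  moreover have "U (zs @ p) \<subseteq> U p"
    by (induction zs) (use UN_children in fastforce)+
  ultimately show ?thesis by simp
qed

lemma U_subset: "U p \<subseteq> pverts G"
  using U_mono[of "[]" p] U_Nil by simp

lemma finite_U: "finite (U p)"
  using U_subset G.pair_finite_verts finite_subset by blast

text \<open>A vertex of \<open>U (j # p)\<close> has escaped the bag \<open>X p\<close>, so its own
  node lies strictly below \<open>p\<close>, under some child \<open>i # p\<close>. Disjointness of
  siblings gives \<open>i = j\<close>.\<close>

lemma U_X_imp_suffix: "v \<in> U p \<Longrightarrow> v \<in> X q \<Longrightarrow> suffix p q"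
proof (induction p)
  case (Cons j p)
  have v: "v \<in> U p" "v \<notin> X p" using Cons.prems(1) UN_children[of p] by auto
  then obtain zs where zs: "q = zs @ p" using Cons by (auto simp: suffix_def)
  with v Cons.prems(2) have "zs \<noteq> []" by auto
  then obtain ys i where q: "q = ys @ i # p" using zs by (cases zs rule: rev_cases) auto
  then have "v \<in> U (i # p)"
    using U_mono[of "i # p" q] X_subset[of q] Cons.prems(2) by (auto simp: suffix_def)
  with Cons.prems(1) q show ?case using disjoint_children by (auto simp: suffix_def)
qed simp

text \<open>Descending to the child that contains \<open>v\<close> at least halves a nonempty set,
  so the descent ends in a bag.\<close>

lemma ex_bag: "v \<in> U p \<Longrightarrow> \<exists>q. v \<in> X q"
proof (induction "card (U p)" arbitrary: p rule: less_induct)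
  case less
  show ?case
  proof (cases "v \<in> X p")
    case False
    with less.prems UN_children[of p] obtain j where j: "v \<in> U (j # p)" by blast
    have "card (U p) > 0" using less.prems finite_U by (auto simp: card_gt_0_iff)
    with card_child[of j p] have "card (U (j # p)) < card (U p)" by linarith
    with less.hyps j show ?thesis by blast
  qed blast
qed

lemma X_iff: "v \<in> pverts G \<Longrightarrow> v \<in> X p \<longleftrightarrow> node_of v = p"
proof -
  assume "v \<in> pverts G"
  then have *: "v \<in> X (node_of v)"
    unfolding node_of_def using ex_bag[of v "[]"] U_Nil by (auto intro: someI)
  \<comment> \<open>Two nodes whose bags contain \<open>v\<close> are suffixes of each
    other.\<close>
  moreover have "p = q" if "v \<in> X p" "v \<in> X q" for p q
    using U_X_imp_suffix that X_subset by (meson subsetD suffix_order.antisym)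
  ultimately show ?thesis by blast
qed

lemma U_iff: "v \<in> pverts G \<Longrightarrow> v \<in> U p \<longleftrightarrow> suffix p (node_of v)"
  using U_X_imp_suffix X_iff X_subset U_mono by (metis subsetD)

lemma node_of_in_nodes: "v \<in> pverts G \<Longrightarrow> node_of v \<in> nodes"
  using U_iff[of v "node_of v"] by (auto simp: nodes_def)

text \<open>Walk down from the root to \<open>p\<close>. While \<open>v\<close> shares the current
  set with \<open>u\<close>, the next split puts it into the bag or into the part of
  \<open>u\<close>, never into a sibling part.\<close>

lemma arc_comparable:
  assumes arc: "(u, v) \<in> parcs G" and u: "u \<in> U p"
  shows "suffix p (node_of v) \<or> suffix (node_of v) p"
  using u
proof (induction p)
  case (Cons j p)
  have v: "v \<in> pverts G" using arc by (rule G.in_arcsD2)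
  from Cons.prems have "u \<in> U p" using UN_children[of p] by blast
  with Cons.IH consider "suffix (node_of v) p" | "v \<in> U p" using U_iff[OF v] by blast
  then show ?case
  proof cases
    case 1
    then show ?thesis by (simp add: suffix_ConsI)
  next
    case 2
    with child_nbhd[OF arc Cons.prems] consider "v \<in> X p" | "v \<in> U (j # p)" by blast
    then show ?thesis using X_iff[OF v] U_iff[OF v] by cases (auto simp: suffix_ConsI)
  qed
qed simp

section \<open>Depth, degree and height bounds\<close>

lemma card_U_pow: "card (U p) * 2 ^ length p \<le> card (pverts G)"
proof (induction p)
  case (Cons j p)
  have "card (U (j # p)) * 2 ^ length (j # p) = (2 * card (U (j # p))) * 2 ^ length p" by simp
  also have "\<dots> \<le> card (U p) * 2 ^ length p" using card_child by (rule mult_right_mono) simp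
  finally show ?case using Cons.IH by linarith
qed (simp add: U_Nil)

lemma length_node_le:
  assumes "p \<in> nodes"
  shows "real (length p) \<le> log 2 (real (card (pverts G)))"
proof (cases "U p = {}")
  case True
  with assms have "p = []" "pverts G = {}" by (auto simp: nodes_def U_Nil)
  then show ?thesis by (simp add: log_def) \<comment> \<open>\<open>G\<close> is empty and \<open>log 2 0 = 0\<close>\<close>
next
  case False
  then have "card (U p) \<ge> 1" using finite_U by (simp add: Suc_leI card_gt_0_iff)
  then have "2 ^ length p \<le> card (U p) * 2 ^ length p" by simp
  then have "2 ^ length p \<le> card (pverts G)" using card_U_pow[of p] by linarith
  then have "2 ^ length p \<le> real (card (pverts G))" by (metis of_nat_le_iff of_nat_numeral of_nat_power)
  moreover from this have "0 < real (card (pverts G))"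
    by (rule less_le_trans[rotated]) simp
  ultimately show ?thesis by (simp add: le_log_iff powr_realpow)
qed

text \<open>Nodes are lists over the alphabet \<open>{..<5}\<close> of length at most the binary
  logarithm of the number of vertices, so there are finitely many.\<close>

lemma suffix_closed_nodes: "suffix_closed nodes"
proof
  have "set p \<subseteq> {..<5}" if "U p \<noteq> {}" for p
    using that
  proof (induction p)
    case (Cons j p)
    then have "U p \<noteq> {}" using UN_children[of p] by blast
    with Cons child_empty[of j p] show ?case by (auto simp: not_le[symmetric])
  qed simp
  moreover have "length p \<le> nat \<lfloor>log 2 (real (card (pverts G)))\<rfloor>" if "p \<in> nodes" for p
    using length_node_le[OF that] by (simp add: le_nat_iff le_floor_iff)
  ultimately have "nodes \<subseteq> {p. set p \<subseteq> {..<5} \<and> length p \<le> nat \<lfloor>log 2 (real (card (pverts G)))\<rfloor>}"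
    by (auto simp: nodes_def)
  then show "finite nodes" by (rule finite_subset) (simp add: finite_lists_length_le)
  show "p \<in> nodes" if "j # p \<in> nodes" for j p
    using that UN_children[of p] by (auto simp: nodes_def)
qed (simp add: nodes_def)

interpretation T: suffix_closed nodes by (rule suffix_closed_nodes)

lemma preimg_bag: "preimg G (to_nat \<circ> node_of) {to_nat p} = X p"
  using X_iff X_subset U_subset by (fastforce simp: preimg_def)

lemma preimg_subtree:
  assumes "p \<in> nodes"
  shows "preimg G (to_nat \<circ> node_of) (subtree (list_tree nodes) (to_nat p)) = U p"
proof -
  have "preimg G (to_nat \<circ> node_of) (subtree (list_tree nodes) (to_nat p)) = {v \<in> pverts G. v \<in> U p}"
    using U_iff node_of_in_nodes by (auto simp: preimg_def T.subtree_list_tree[OF assms])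
  then show ?thesis using U_subset by blast
qed

lemma gen_elim_forest_list_tree: "gen_elim_forest G (list_tree nodes) (to_nat \<circ> node_of)"
  unfolding gen_elim_forest_def
proof (intro conjI)
  show "(to_nat \<circ> node_of) ` pverts G \<subseteq> pverts (list_tree nodes)"
    using node_of_in_nodes by (auto simp: list_tree_def)
  \<comment> \<open>\<open>arc_comparable\<close> is applied at \<open>node_of u\<close>, whose set
    contains \<open>u\<close>.\<close>
  have "suffix (node_of u) (node_of v) \<or> suffix (node_of v) (node_of u)" if "(u, v) \<in> parcs G" for u v
    using arc_comparable[OF that] U_iff G.in_arcsD1[OF that] by blast
  then show "\<forall>(u, v) \<in> parcs G.
      anc (list_tree nodes) ((to_nat \<circ> node_of) u) ((to_nat \<circ> node_of) v) \<or>
      anc (list_tree nodes) ((to_nat \<circ> node_of) v) ((to_nat \<circ> node_of) u)"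
    using node_of_in_nodes G.in_arcsD1 G.in_arcsD2 by (auto simp: T.anc_list_tree)
qed (rule T.rooted_forest_list_tree)

text \<open>Six colours already contain three disjoint pairs, so merging gets down to five groups,
  within the seven allowed.\<close>

lemma out_degree_le_7: "out_degree (list_tree nodes) x \<le> 7"
proof -
  have "j < 5" if "j # p \<in> nodes" for j p
    using that child_empty[of j p] by (auto simp: nodes_def not_le[symmetric])
  then have "out_degree (list_tree nodes) x \<le> 5" by (rule T.out_degree_list_tree)
  then show ?thesis by simp
qed

lemma forest_height_le: "real (forest_height (list_tree nodes)) \<le> 1 + log 2 (real (card (pverts G)))"
proof -
  obtain q where "q \<in> nodes" "forest_height (list_tree nodes) = length q + 1"
    by (rule T.forest_height_list_tree)
  with length_node_le show ?thesis by fastforce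
qed

text \<open>Along a path from the root the bag bounds form a geometric progression with ratio
  \<open>1 / 2 powr \<alpha>\<close>, which is below 1 because \<open>\<alpha>\<close> is positive.
  The full series bounds every path.\<close>

lemma gef_height_le:
  assumes "0 < \<alpha>" "c \<ge> 0"
    and X: "\<And>p. real (card (X p)) \<le> c * (n / 2 ^ length p) powr \<alpha>" and "n \<ge> 0"
  shows "real (gef_height G (list_tree nodes) (to_nat \<circ> node_of)) \<le> c / (1 - 1 / 2 powr \<alpha>) * n powr \<alpha>"
proof -
  let ?s = "\<lambda>x. \<Sum>y | anc (list_tree nodes) y x. card (preimg G (to_nat \<circ> node_of) {y})"
  define r :: real where "r = 1 / 2 powr \<alpha>"
  have r: "0 < r" "r < 1" using assms(1) by (simp_all add: r_def)
  have pow: "(n / 2 ^ i) powr \<alpha> = n powr \<alpha> * r ^ i" for i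
  proof -
    have "(2 ^ i) powr \<alpha> = (2 powr real i) powr \<alpha>" by (simp add: powr_realpow)
    also have "\<dots> = (2 powr \<alpha>) powr real i" by (simp add: powr_powr mult.commute)
    also have "\<dots> = (2 powr \<alpha>) ^ i" by (simp add: powr_realpow)
    finally show ?thesis using \<open>n \<ge> 0\<close> by (simp add: powr_divide r_def power_one_over)
  qed
  have "Max (?s ` pverts (list_tree nodes)) \<in> ?s ` to_nat ` nodes"
    using T.finite_T T.Nil_in by (intro Max_in[THEN subsetD[rotated]]) auto
  then obtain q where q: "q \<in> nodes" "gef_height G (list_tree nodes) (to_nat \<circ> node_of) = ?s (to_nat q)"
    by (auto simp: gef_height_def)
  have inj: "inj_on (\<lambda>i. drop i q) {..length q}"
    by (auto simp: inj_on_def dest: arg_cong[where f = length])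
  have "?s (to_nat q) = (\<Sum>i\<le>length q. card (X (drop i q)))"
    unfolding T.ancestors_list_tree[OF q(1)]
    by (simp add: sum.reindex inj preimg_bag)
  then have "real (?s (to_nat q)) = (\<Sum>i\<le>length q. real (card (X (drop i q))))" by simp
  \<comment> \<open>\<open>drop i q\<close> has depth \<open>length q - i\<close>; the sum is then
    reversed so that it runs from the root downwards.\<close>
  also have "\<dots> \<le> (\<Sum>i\<le>length q. c * (n / 2 ^ (length q - i)) powr \<alpha>)"
    using X[of "drop _ q"] by (intro sum_mono) simp
  also have "\<dots> = (\<Sum>i\<le>length q. c * (n / 2 ^ i) powr \<alpha>)"
    by (rule sum.nat_diff_reindex[of "\<lambda>i. c * (n / 2 ^ i) powr \<alpha>" "Suc (length q)", unfolded lessThan_Suc_atMost diff_Suc_Suc])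
  also have "\<dots> = (\<Sum>i\<le>length q. c * n powr \<alpha> * r ^ i)"
    by (simp add: pow mult.assoc)
  also have "\<dots> = c * n powr \<alpha> * (\<Sum>i\<le>length q. r ^ i)" by (simp add: sum_distrib_left)
  also have "\<dots> \<le> c * n powr \<alpha> * (1 / (1 - r))"
    using assms(2) r by (intro mult_left_mono) (auto simp: sum_gp0 divide_simps)
  finally show ?thesis using q by (simp add: r_def)
qed

end

section \<open>The recursive construction and the choice of constants\<close>

theorem theorem4p4:
  fixes C :: "'a pair_pre_digraph set" and \<alpha> :: real
  assumes "graph_class C"
    and "hereditary C"
    and "0 < \<alpha>" and "\<alpha> < 1"
    and "separable C \<alpha>"
  shows "\<exists>c\<^sub>1 c\<^sub>2 c\<^sub>3 :: real. \<forall>G\<in>C. \<exists>(F :: nat pair_pre_digraph) (\<eta> :: 'a \<Rightarrow> nat).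
    let n = real (card (pverts G)) in
      gen_elim_forest G F \<eta> \<and>
      (card (roots F) = 1 \<and> (\<forall>x\<in>pverts F. out_degree (with_proj F) x \<le> 7)) \<and>
      (real (forest_height F) \<le> 1 + log 2 n \<and> real (gef_height G F \<eta>) \<le> c\<^sub>1 * n powr \<alpha>) \<and>
      (\<forall>x\<in>pverts F. let i = depth F x in
        real (card (preimg G \<eta> {x})) \<le> c\<^sub>2 * (n / 2 ^ i) powr \<alpha> \<and>
        real (card (preimg G \<eta> (subtree F x))) \<le> n / 2 ^ i \<and>
        real (card (nbhd G (preimg G \<eta> (subtree F x)))) \<le> c\<^sub>3 * (n / 2 ^ i) powr \<alpha>)"
proof -
  obtain K where K: "K > 0" "\<And>G. G \<in> C \<Longrightarrow> coloured_separators G K \<alpha>"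
    using separable_coloured_separators[OF assms(1,2,5)] by blast
  obtain c where c: "c > 0" "2 * K * (1 + c) powr \<alpha> + c / 2 \<le> c / 2 powr \<alpha>"
    by (rule boundary_constant[OF assms(3,4)])
  \<comment> \<open>\<open>c2\<close> bounds the bags, \<open>c\<close> the neighbourhoods and
    \<open>c2 / (1 - 1 / 2 powr \<alpha>)\<close> the height; all are chosen before
    \<open>G\<close>.\<close>
  define c2 where "c2 = 2 * K * (1 + c) powr \<alpha>"
  have c2: "c2 \<ge> 0" using K(1) by (simp add: c2_def)
  show ?thesis
  proof (intro exI ballI)
    fix G assume G: "G \<in> C"
    then have pg: "pair_graph G" using assms(1) by (simp add: graph_class_def)
    define n where "n = real (card (pverts G))"
    define good where "good m U XP \<longleftrightarrow> splits G U (fst XP) (snd XP) \<and>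
      real (card (fst XP)) \<le> c2 * m powr \<alpha> \<and> (\<forall>j. small_part G \<alpha> c (m / 2) (snd XP j))"
      for m U and XP :: "'a set \<times> (nat \<Rightarrow> 'a set)"
    define split where "split m U = (SOME XP. good m U XP)" for m U
    have split: "good m U (split m U)" if "small_part G \<alpha> c m U" for m U
    proof -
      have "\<exists>X P. good m U (X, P)"
        using split_small_part[OF pg K(2)[OF G] K(1) assms(3,4) c that] by (simp add: good_def c2_def)
      then show ?thesis unfolding split_def by (metis someI)
    qed
    \<comment> \<open>\<open>S\<close> stands for \<open>U p\<close>. The node \<open>p\<close> has
      depth \<open>length p\<close>, so it is split at scale
      \<open>n / 2 ^ length p\<close>.\<close>
    define U where "U = rec_list (pverts G) (\<lambda>j p S. snd (split (n / 2 ^ length p) S) j)"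
    define X where "X p = fst (split (n / 2 ^ length p) (U p))" for p
    have U_simps: "U [] = pverts G" "\<And>j p. U (j # p) = snd (split (n / 2 ^ length p) (U p)) j"
      by (simp_all add: U_def)
    \<comment> \<open>The invariant at \<open>p\<close> makes the chosen split good, and a good
      split passes the invariant to each child at half the scale. At the root the neighbourhood is
      empty.\<close>
    have small: "small_part G \<alpha> c (n / 2 ^ length p) (U p)" for p
    proof (induction p)
      case Nil
      have "nbhd G (pverts G) = {}" by (simp add: nbhd_def)
      with c(1) show ?case by (simp add: U_simps small_part_def n_def)
    next
      case (Cons j p)
      from split[OF this] show ?case by (simp add: good_def U_simps mult.commute)
    qed
    have bag: "real (card (X p)) \<le> c2 * (n / 2 ^ length p) powr \<alpha>" for p
      using split[OF small] by (simp add: good_def X_def)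
    interpret separator_tree G U X
      by (intro separator_tree.intro) (use pg U_simps split[OF small] in \<open>simp_all add: good_def X_def\<close>)
    interpret T: suffix_closed nodes by (rule suffix_closed_nodes)
    have "real (gef_height G (list_tree nodes) (to_nat \<circ> node_of)) \<le> c2 / (1 - 1 / 2 powr \<alpha>) * n powr \<alpha>"
      using assms(3) c2 bag by (rule gef_height_le) (simp add: n_def)
    moreover have "\<forall>x\<in>pverts (list_tree nodes). let i = depth (list_tree nodes) x in
        real (card (preimg G (to_nat \<circ> node_of) {x})) \<le> c2 * (n / 2 ^ i) powr \<alpha> \<and>
        real (card (preimg G (to_nat \<circ> node_of) (subtree (list_tree nodes) x))) \<le> n / 2 ^ i \<and>
        real (card (nbhd G (preimg G (to_nat \<circ> node_of) (subtree (list_tree nodes) x)))) \<le> c * (n / 2 ^ i) powr \<alpha>"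
    proof
      fix x assume "x \<in> pverts (list_tree nodes)"
      then obtain p where "p \<in> nodes" "x = to_nat p" by (auto simp: list_tree_def)
      with bag[of p] small[of p] show "let i = depth (list_tree nodes) x in
        real (card (preimg G (to_nat \<circ> node_of) {x})) \<le> c2 * (n / 2 ^ i) powr \<alpha> \<and>
        real (card (preimg G (to_nat \<circ> node_of) (subtree (list_tree nodes) x))) \<le> n / 2 ^ i \<and>
        real (card (nbhd G (preimg G (to_nat \<circ> node_of) (subtree (list_tree nodes) x)))) \<le> c * (n / 2 ^ i) powr \<alpha>"
        by (simp add: preimg_bag preimg_subtree T.depth_list_tree small_part_def)
    qed
    ultimately show "let n = real (card (pverts G)) in
      gen_elim_forest G (list_tree nodes) (to_nat \<circ> node_of) \<and>
      (card (roots (list_tree nodes)) = 1 \<and>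
        (\<forall>x\<in>pverts (list_tree nodes). out_degree (with_proj (list_tree nodes)) x \<le> 7)) \<and>
      (real (forest_height (list_tree nodes)) \<le> 1 + log 2 n \<and>
        real (gef_height G (list_tree nodes) (to_nat \<circ> node_of)) \<le> c2 / (1 - 1 / 2 powr \<alpha>) * n powr \<alpha>) \<and>
      (\<forall>x\<in>pverts (list_tree nodes). let i = depth (list_tree nodes) x in
        real (card (preimg G (to_nat \<circ> node_of) {x})) \<le> c2 * (n / 2 ^ i) powr \<alpha> \<and>
        real (card (preimg G (to_nat \<circ> node_of) (subtree (list_tree nodes) x))) \<le> n / 2 ^ i \<and>
        real (card (nbhd G (preimg G (to_nat \<circ> node_of) (subtree (list_tree nodes) x)))) \<le> c * (n / 2 ^ i) powr \<alpha>)"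
      using gen_elim_forest_list_tree forest_height_le out_degree_le_7 T.roots_list_tree
      unfolding Let_def n_def by simp
  qed
qed

end
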